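(* Let $(\mu,P)$ be a time-homogeneous Markov chain on a countable state space $S$ (with $\sigma$-algebra $2^S$), and let $(A_1,B_1),\dots,(A_k,B_k)$ with $A_i,B_i\subseteq S$ be a Streett acceptance condition such that $$\mathsf P_\mu\Big(\bigcap_{i=1}^k\mathrm{Fin}(A_i)\cup\mathrm{Inf}(B_i)\Big)=1.$$ Then there exist: - $I\subseteq S$; - $V_0:S\to\mathbb R_{\ge0}$ with $\mu V_0=0$; - $J_i\subseteq I\setminus A_i$; - $V_i,W_i:S\to\mathbb R_{\ge0}$; - $d_i:\mathbb R_{\ge0}\to\mathbb R_{>0}$; - $p_i:\mathbb R_{\ge0}\to(0,1]$ ($i=1,\dots,k$); such that, for every $i=1,\dots,k$: 1. $\forall s\notin A_i$: $PV_i(s)\le V_i(s)$; 2. $\forall s\in A_i$: $V_i(s)\ge1$; 3. $\exists\gamma_i>0\ \forall s\in J_i$: $V_i(s)\le1-\gamma_i$; 4. $\forall s\in I\setminus(B_i\cup J_i)$: $W_i(s)>0$ and $PW_i(s)\le W_i(s)$; 5. $\forall s\in I\cap(B_i\cup J_i)$: $W_i(s)=0$; 6. $\forall r>0\ \forall s\in I\setminus(B_i\cup J_i)$: if $W_i(s)=r$ then $P(s,\{s':W_i(s')\le r-d_i(r)\})\ge p_i(r)$; 7. $p_i$ and $d_i$ are non-increasing on $\mathbb R_{>0}$; and moreover $\forall s\in I$: $PV_0(s)\le V_0(s)$, and $\forall s\notin I$: $V_0(s)\ge1$.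
   Context: Setting. - $\mathsf P_\mu$ is the law on $S^\omega$ of the time-homogeneous Markov chain $(\Phi_n)$ with initial distribution $\mu$ and kernel $P$. - $\mathrm{Fin}(A)=\bigcup_{n}\bigcap_{m\ge n}\{\Phi_m\notin A\}$ and $\mathrm{Inf}(A)=\bigcap_n\bigcup_{m\ge n}\{\Phi_m\in A\}$. Notation. $PV(s)=\sum_u V(u)P(s,\{u\})$ and $\mu V=\sum_s V(s)\mu(\{s\})$. *)

theory Defs
  imports "HOL-Probability.Probability"
begin

text \<open>A probability measure on a countable set with the full \<open>\<sigma>\<close>-algebra is a \<^typ>\<open>'s pmf\<close>, so a
  time-homogeneous Markov chain is an initial \<open>\<mu> :: 's pmf\<close> with a kernel \<open>P :: 's \<Rightarrow> 's pmf\<close>, and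
  \<open>P(s, X)\<close> is \<open>measure_pmf.prob (P s) X\<close>. The path space \<open>S\<^sup>\<omega>\<close> is \<^typ>\<open>nat \<Rightarrow> 's\<close> with the product
  \<open>\<sigma>\<close>-algebra, and \<open>\<Phi>\<^sub>n\<close> is the coordinate map \<open>\<lambda>\<omega>. \<omega> n\<close>.\<close>

definition chain_step :: "'s pmf \<Rightarrow> ('s \<Rightarrow> 's pmf) \<Rightarrow> nat \<Rightarrow> (nat \<Rightarrow> 's) \<Rightarrow> 's measure" where
  "chain_step \<mu> P i \<omega> = measure_pmf (case i of 0 \<Rightarrow> \<mu> | Suc n \<Rightarrow> P (\<omega> n))"

interpretation chain: Ionescu_Tulcea "chain_step \<mu> P" "\<lambda>_. count_space UNIV"
  for \<mu> :: "'s pmf" and P :: "'s \<Rightarrow> 's pmf"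
proof (rule Ionescu_Tulcea.intro)
  fix i :: nat
  show "chain_step \<mu> P i \<in> PiM {0..<i} (\<lambda>_. count_space UNIV) \<rightarrow>\<^sub>M subprob_algebra (count_space UNIV)"
  proof (cases i)
    case 0
    then show ?thesis
      by (simp add: chain_step_def[abs_def] measure_pmf_in_subprob_algebra)
  next
    case (Suc n)
    have "(\<lambda>\<omega>. measure_pmf (P (\<omega> n))) \<in>
        PiM {0..<Suc n} (\<lambda>_. count_space UNIV) \<rightarrow>\<^sub>M subprob_algebra (count_space UNIV)"
    proof (rule measurable_compose[where N = "count_space UNIV" and g = "\<lambda>s. measure_pmf (P s)"])
      show "(\<lambda>\<omega>. \<omega> n) \<in> PiM {0..<Suc n} (\<lambda>_. count_space UNIV) \<rightarrow>\<^sub>M count_space UNIV"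
        by (rule measurable_component_singleton) simp
    qed (simp add: measure_pmf_in_subprob_algebra)
    then show ?thesis
      by (simp add: chain_step_def[abs_def] Suc)
  qed
  show "prob_space (chain_step \<mu> P i \<omega>)" for i \<omega>
    by (simp add: chain_step_def measure_pmf.prob_space_axioms)
qed

text \<open>The law \<open>\<P>\<^sub>\<mu>\<close> of the chain, obtained from the Ionescu-Tulcea extension theorem.\<close>

definition path_law :: "'s pmf \<Rightarrow> ('s \<Rightarrow> 's pmf) \<Rightarrow> (nat \<Rightarrow> 's) measure" where
  "path_law \<mu> P = chain.PF.lim \<mu> P"

lemma sets_path_law [measurable_cong]:
  "sets (path_law \<mu> P) = sets (PiM UNIV (\<lambda>_. count_space UNIV))"
  by (simp add: path_law_def)

lemma space_path_law [simp]: "space (path_law \<mu> P) = UNIV"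
  using sets_eq_imp_space_eq[OF sets_path_law] by (auto simp: space_PiM)

lemma emeasure_chain_C:
  "emeasure (chain.C \<mu> P 0 (Suc n) (\<lambda>_. undefined)) (PiE {0..<Suc n} (\<lambda>i. {x i})) =
     ennreal (pmf \<mu> (x 0) * (\<Prod>i<n. pmf (P (x i)) (x (Suc i))))"
proof (induction n)
  case 0
  have X: "PiE {0..<Suc 0} (\<lambda>i. {x i}) \<in> sets (PiM {0..<Suc 0} (\<lambda>_. count_space UNIV))"
    by (intro sets_PiM_I_finite) auto
  have sp: "(\<lambda>_. undefined) \<in> space (PiM {0..<0::nat} (\<lambda>_. count_space UNIV))"
    by (simp add: space_PiM)
  have C: "chain.C \<mu> P 0 (Suc 0) (\<lambda>_. undefined) = chain.eP \<mu> P 0 (\<lambda>_. undefined)"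
    using bind_return[OF chain.measurable_eP sp, of \<mu> P] by simp
  have "(\<lambda>y. (\<lambda>_. undefined)(0 := y)) -` PiE {0..<Suc 0} (\<lambda>i. {x i}) = {x 0}"
    by (rule set_eqI) (simp add: PiE_iff extensional_def)
  then show ?case
    unfolding C using chain.emeasure_eP[OF sp X, of \<mu> P]
    by (simp add: chain_step_def emeasure_pmf_single)
next
  case (Suc n)
  let ?K = "\<lambda>_. count_space UNIV :: 'a measure"
  let ?C = "chain.C \<mu> P 0 (Suc n) (\<lambda>_. undefined)"
  let ?X = "\<lambda>n. PiE {0..<Suc n} (\<lambda>i. {x i})"
  let ?q = "ennreal (pmf (P (x n)) (x (Suc n)))"
  have X: "?X m \<in> sets (PiM {0..<Suc m} ?K)" for m
    by (intro sets_PiM_I_finite) auto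
  have sp: "(\<lambda>_. undefined) \<in> space (PiM {0..<0::nat} ?K)"
    by (simp add: space_PiM)
  have sets_C: "sets ?C = sets (PiM {0..<Suc n} ?K)"
    using chain.sets_C[OF sp, of \<mu> P "Suc n"] by (simp only: add_0)
  have space_C: "space ?C = space (PiM {0..<Suc n} ?K)"
    using sets_C by (rule sets_eq_imp_space_eq)
  have step: "emeasure (chain.eP \<mu> P (Suc n) \<omega>) (?X (Suc n)) = ?q * indicator (?X n) \<omega>"
    if \<omega>: "\<omega> \<in> space (PiM {0..<Suc n} ?K)" for \<omega>
  proof -
    have ext: "\<omega> \<in> extensional {0..<Suc n}"
      using \<omega> by (simp add: space_PiM PiE_iff)
    have "(\<lambda>y. fun_upd \<omega> (Suc n) y) -` ?X (Suc n) = (if \<omega> \<in> ?X n then {x (Suc n)} else {})"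
    proof (rule set_eqI)
      fix y
      have "fun_upd \<omega> (Suc n) y \<in> extensional {0..<Suc (Suc n)}"
        using ext by (simp add: extensional_def)
      moreover have "(\<forall>i<Suc (Suc n). fun_upd \<omega> (Suc n) y i = x i) \<longleftrightarrow> y = x (Suc n) \<and> (\<forall>i<Suc n. \<omega> i = x i)"
        unfolding All_less_Suc[of "Suc n"] by (intro conj_cong all_cong) simp_all
      ultimately show "y \<in> (\<lambda>y. fun_upd \<omega> (Suc n) y) -` ?X (Suc n) \<longleftrightarrow> y \<in> (if \<omega> \<in> ?X n then {x (Suc n)} else {})"
        using ext by (simp add: PiE_iff Ball_def del: fun_upd_apply)
    qed
    moreover have "\<omega> n = x n" if "\<omega> \<in> ?X n"
      using that by (auto simp: PiE_iff)
    ultimately show ?thesis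
      using chain.emeasure_eP[OF \<omega> X, of \<mu> P]
      by (auto simp: chain_step_def emeasure_pmf_single)
  qed
  have "emeasure (chain.C \<mu> P 0 (Suc (Suc n)) (\<lambda>_. undefined)) (?X (Suc n)) =
      emeasure (?C \<bind> chain.eP \<mu> P (Suc n)) (?X (Suc n))"
    by (simp only: chain.C.simps(2)[of _ _ _ "Suc n"] add_0)
  also have "\<dots> = (\<integral>\<^sup>+\<omega>. emeasure (chain.eP \<mu> P (Suc n) \<omega>) (?X (Suc n)) \<partial>?C)"
  proof (rule emeasure_bind[OF _ _ X])
    show "space ?C \<noteq> {}"
      by (simp only: space_C) (auto simp: space_PiM PiE_eq_empty_iff)
    show "chain.eP \<mu> P (Suc n) \<in> ?C \<rightarrow>\<^sub>M subprob_algebra (PiM {0..<Suc (Suc n)} ?K)"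
      by (subst measurable_cong_sets[OF sets_C refl]) (rule chain.measurable_eP)
  qed
  also have "\<dots> = (\<integral>\<^sup>+\<omega>. ?q * indicator (?X n) \<omega> \<partial>?C)"
    by (intro nn_integral_cong step) (simp only: space_C)
  also have "\<dots> = ?q * emeasure ?C (?X n)"
    by (intro nn_integral_cmult_indicator) (simp only: sets_C X)
  also have "\<dots> = ennreal (pmf \<mu> (x 0) * (\<Prod>i<Suc n. pmf (P (x i)) (x (Suc i))))"
    unfolding Suc.IH by (simp add: ennreal_mult[symmetric] prod_nonneg mult_ac)
  finally show ?case .
qed

lemma emeasure_path_law_cylinder:
  "emeasure (path_law \<mu> P) {\<omega>. \<forall>i\<le>n. \<omega> i = x i} =
     ennreal (pmf \<mu> (x 0) * (\<Prod>i<n. pmf (P (x i)) (x (Suc i))))"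
proof -
  let ?J = "{0..<Suc n}" and ?X = "PiE {0..<Suc n} (\<lambda>i. {x i})"
  have X: "?X \<in> sets (PiM ?J (\<lambda>_. count_space UNIV))"
    by (intro sets_PiM_I_finite) auto
  have "{\<omega>. \<forall>i\<le>n. \<omega> i = x i} = prod_emb UNIV (\<lambda>_. count_space UNIV) ?J ?X"
    by (auto simp: prod_emb_def space_PiM PiE_iff less_Suc_eq_le)
  then have "emeasure (path_law \<mu> P) {\<omega>. \<forall>i\<le>n. \<omega> i = x i} = emeasure (chain.CI \<mu> P ?J) ?X"
    using chain.lim[OF _ X, of \<mu> P] by (simp add: path_law_def)
  also have "\<dots> = emeasure (chain.C \<mu> P 0 (Suc n) (\<lambda>_. undefined)) ?X"
    using chain.emeasure_CI[of ?J "Suc n", OF _ X, of \<mu> P] by (simp add: prod_emb_id)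
  finally show ?thesis
    by (simp only: emeasure_chain_C)
qed

lemma prob_space_path_law: "prob_space (path_law \<mu> P)"
proof
  have "emeasure (path_law \<mu> P) (prod_emb UNIV (\<lambda>_. count_space UNIV) {} (space (PiM {} (\<lambda>_. count_space UNIV))))
      = emeasure (chain.CI \<mu> P {}) (space (PiM {} (\<lambda>_. count_space UNIV)))"
    unfolding path_law_def by (rule chain.lim) auto
  moreover have "prod_emb UNIV (\<lambda>_. count_space UNIV) {} (space (PiM {} (\<lambda>_. count_space UNIV)))
      = (UNIV :: (nat \<Rightarrow> 'a) set)"
    by (auto simp: prod_emb_def space_PiM)
  moreover have "space (chain.CI \<mu> P {}) = space (PiM {} (\<lambda>_. count_space UNIV))"
    by (simp add: chain.CI_def)
  ultimately show "emeasure (path_law \<mu> P) (space (path_law \<mu> P)) = 1"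
    using prob_space.emeasure_space_1[OF chain.PF.prob_space_P[of "{}" \<mu> P]] by simp
qed

definition fin_often :: "'s set \<Rightarrow> (nat \<Rightarrow> 's) set" where
  "fin_often A = (\<Union>n. \<Inter>m\<in>{n..}. {\<omega>. \<omega> m \<notin> A})"

definition inf_often :: "'s set \<Rightarrow> (nat \<Rightarrow> 's) set" where
  "inf_often A = (\<Inter>n. \<Union>m\<in>{n..}. {\<omega>. \<omega> m \<in> A})"

lemma coordinate_event_sets [measurable]: "{\<omega>. \<omega> m \<in> A} \<in> sets (path_law \<mu> P)"
proof -
  have "(\<lambda>\<omega>. \<omega> m) -` A \<inter> space (PiM UNIV (\<lambda>_. count_space UNIV)) \<in> sets (PiM UNIV (\<lambda>_. count_space UNIV))"
    by (rule measurable_sets[OF measurable_component_singleton]) auto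
  then show ?thesis
    by (simp add: sets_path_law vimage_def space_PiM)
qed

lemma fin_often_sets: "fin_often A \<in> sets (path_law \<mu> P)"
proof -
  have "{\<omega>. \<omega> m \<notin> A} \<in> sets (path_law \<mu> P)" for m
    using coordinate_event_sets[of m "- A"] by simp
  then show ?thesis
    unfolding fin_often_def by (intro sets.countable_UN' sets.countable_INT') auto
qed

lemma inf_often_sets: "inf_often A \<in> sets (path_law \<mu> P)"
  unfolding inf_often_def by (intro sets.countable_INT' sets.countable_UN') auto

text \<open>\<open>pmf_int (P s) V\<close> is \<open>PV(s)\<close> and \<open>pmf_int \<mu> V\<close> is \<open>\<mu>V\<close>, for nonnegative \<open>V\<close>. The sum may diverge
  to \<open>\<infinity>\<close>, hence the value in \<^typ>\<open>ennreal\<close>: \<open>PV(s) \<le> V(s)\<close> includes its convergence.\<close>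

definition pmf_int :: "'s pmf \<Rightarrow> ('s \<Rightarrow> real) \<Rightarrow> ennreal" where
  "pmf_int \<nu> V = (\<integral>\<^sup>+u. ennreal (V u) \<partial>measure_pmf \<nu>)"

lemma pmf_int_eq_sum: "pmf_int \<nu> V = (\<integral>\<^sup>+u. ennreal (V u) * ennreal (pmf \<nu> u) \<partial>count_space UNIV)"
  by (simp add: pmf_int_def nn_integral_measure_pmf mult.commute)

end

theory Submission
  imports Defs
begin

text \<open>
  Take \<open>I\<close> to be the set of reachable states and \<open>V\<^sub>0\<close> the indicator of its complement. Let \<open>V\<^sub>i(s)\<close> be
  the probability of ever visiting \<open>A\<^sub>i\<close> from \<open>s\<close>, and \<open>J\<^sub>i = {s \<in> I. V\<^sub>i(s) \<le> 1/2}\<close>. A path that stays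
  forever in \<open>{V\<^sub>i > 1/2} - A\<^sub>i\<close> has probability zero: the supremum \<open>c\<close> of these probabilities over the
  starting state satisfies \<open>c \<le> c/2\<close>. Hence the Streett condition forces almost every path from \<open>I\<close>
  to leave \<open>C = {V\<^sub>i > 1/2} - B\<^sub>i\<close>, that is, to hit \<open>B\<^sub>i \<union> J\<^sub>i\<close>.

  Enumerate the states. For each starting state, the probability of meeting a state of index at least
  \<open>N\<close> before leaving \<open>C\<close> tends to \<open>0\<close> as \<open>N\<close> grows, so summing these probabilities along a sparse sequence of
  thresholds gives a supermartingale that is finite on \<open>I\<close> and has finite sublevel sets in \<open>C\<close>. Adding
  \<open>1 - E\<^sub>s(2\<^sup>-\<^sup>\<tau>)\<close>, with \<open>\<tau>\<close> the exit time of \<open>C\<close>, makes its drift strictly negative; this is \<open>W\<^sub>i\<close>. Each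
  state of \<open>I \<inter> C\<close> then has a successor with smaller \<open>W\<^sub>i\<close>, and \<open>d\<^sub>i(r)\<close>, \<open>p\<^sub>i(r)\<close> are minima over the finitely
  many states with \<open>W\<^sub>i \<le> r\<close>.
\<close>

section \<open>The Markov property\<close>

text \<open>Law of the first \<open>n + 1\<close> states on a discrete space, where every function
  is measurable; integrals over finitely many coordinates are moved here.\<close>

primrec prefix_pmf :: "'s pmf \<Rightarrow> ('s \<Rightarrow> 's pmf) \<Rightarrow> nat \<Rightarrow> 's list pmf" where
  "prefix_pmf \<mu> P 0 = map_pmf (\<lambda>s. [s]) \<mu>"
| "prefix_pmf \<mu> P (Suc n) =
     bind_pmf (prefix_pmf \<mu> P n) (\<lambda>xs. map_pmf (\<lambda>y. xs @ [y]) (P (last xs)))"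

lemma length_prefix_pmf: "xs \<in> set_pmf (prefix_pmf \<mu> P n) \<Longrightarrow> length xs = Suc n"
  by (induction n arbitrary: xs) auto

text \<open>A nonempty list splits uniquely into its initial part and its last entry, so only
  \<open>zs = xs\<close> contributes to the bind.\<close>

lemma pmf_prefix_pmf_snoc:
  "pmf (prefix_pmf \<mu> P (Suc n)) (xs @ [y]) = pmf (prefix_pmf \<mu> P n) xs * pmf (P (last xs)) y"
proof -
  have eq: "ennreal (pmf (map_pmf (\<lambda>y. zs @ [y]) (P (last zs))) (xs @ [y])) =
      ennreal (pmf (P (last xs)) y) * indicator {xs} zs" for zs
  proof (cases "zs = xs")
    case True
    then show ?thesis
      using pmf_map_inj'[of "\<lambda>y. zs @ [y]" "P (last zs)" y] by (simp add: inj_def)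
  next
    case False
    then have "xs @ [y] \<notin> set_pmf (map_pmf (\<lambda>y. zs @ [y]) (P (last zs)))"
      by auto
    then show ?thesis
      using False by (simp add: pmf_eq_0_set_pmf)
  qed
  have "ennreal (pmf (prefix_pmf \<mu> P (Suc n)) (xs @ [y])) =
      ennreal (pmf (P (last xs)) y) * ennreal (pmf (prefix_pmf \<mu> P n) xs)"
    by (simp only: prefix_pmf.simps ennreal_pmf_bind eq)
      (simp add: nn_integral_cmult_indicator emeasure_pmf_single)
  then show ?thesis
    by (simp add: ennreal_mult[symmetric] mult.commute del: prefix_pmf.simps)
qed

lemma pmf_prefix_pmf:
  "pmf (prefix_pmf \<mu> P n) (map x [0..<Suc n]) = pmf \<mu> (x 0) * (\<Prod>i<n. pmf (P (x i)) (x (Suc i)))"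
proof (induction n)
  case 0
  show ?case
    using pmf_map_inj'[of "\<lambda>y. [y]" \<mu> "x 0"] by (simp add: inj_def)
next
  case (Suc n)
  have "map x [0..<Suc (Suc n)] = map x [0..<Suc n] @ [x (Suc n)]" "last (map x [0..<Suc n]) = x n"
    by simp_all
  then show ?case
    using Suc by (simp only: pmf_prefix_pmf_snoc) simp
qed

lemma prefix_event_eq:
  assumes "length xs = Suc n"
  shows "{\<omega>. map \<omega> [0..<Suc n] = xs} = {\<omega>. \<forall>i\<le>n. \<omega> i = xs ! i}"
  using assms by (auto simp: list_eq_iff_nth_eq less_Suc_eq_le simp del: upt_Suc)

lemma measurable_prefix [measurable]:
  fixes \<mu> :: "'s::countable pmf"
  shows "(\<lambda>\<omega>. map \<omega> [0..<n]) \<in> path_law \<mu> P \<rightarrow>\<^sub>M count_space UNIV"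
proof (induction n)
  case (Suc n)
  have [measurable]: "(\<lambda>\<omega>. \<omega> n) \<in> path_law \<mu> P \<rightarrow>\<^sub>M count_space UNIV"
    using coordinate_event_sets[of n] by (auto simp: measurable_def vimage_def)
  have "(\<lambda>\<omega>. (\<lambda>(xs, y). xs @ [y]) (map \<omega> [0..<n], \<omega> n)) \<in> path_law \<mu> P \<rightarrow>\<^sub>M count_space UNIV"
    using Suc by measurable
  then show ?case
    by simp
qed simp

text \<open>Both measures live on lists of length \<open>Suc n\<close>, of which there are countably
  many, and both give each singleton the weight of the corresponding cylinder.\<close>

lemma distr_prefix:
  fixes \<mu> :: "'s::countable pmf"
  shows "distr (path_law \<mu> P) (count_space UNIV) (\<lambda>\<omega>. map \<omega> [0..<Suc n]) =
    measure_pmf (prefix_pmf \<mu> P n)"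
proof (rule measure_eqI_countable_AE[where \<Omega> = "{xs. length xs = Suc n}"])
  show "AE xs in measure_pmf (prefix_pmf \<mu> P n). xs \<in> {xs. length xs = Suc n}"
    using length_prefix_pmf by (auto simp: AE_measure_pmf_iff)
  show "AE xs in distr (path_law \<mu> P) (count_space UNIV) (\<lambda>\<omega>. map \<omega> [0..<Suc n]).
      xs \<in> {xs. length xs = Suc n}"
    by (subst AE_distr_iff) (simp_all del: upt_Suc)
  fix xs :: "'s list" assume "xs \<in> {xs. length xs = Suc n}"
  then have len: "length xs = Suc n" by simp
  then have xs: "xs = map (nth xs) [0..<Suc n]"
    by (metis map_nth)
  have "emeasure (distr (path_law \<mu> P) (count_space UNIV) (\<lambda>\<omega>. map \<omega> [0..<Suc n])) {xs} =
      emeasure (path_law \<mu> P) {\<omega>. map \<omega> [0..<Suc n] = xs}"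
    by (subst emeasure_distr) (auto simp: vimage_def simp del: upt_Suc)
  also have "\<dots> = ennreal (pmf (prefix_pmf \<mu> P n) xs)"
    unfolding prefix_event_eq[OF len] emeasure_path_law_cylinder
    by (subst xs, subst pmf_prefix_pmf) simp
  finally show "emeasure (distr (path_law \<mu> P) (count_space UNIV) (\<lambda>\<omega>. map \<omega> [0..<Suc n])) {xs} =
      emeasure (prefix_pmf \<mu> P n) {xs}"
    by (simp add: emeasure_pmf_single)
qed (auto intro: countableI_type)

lemma nn_integral_prefix:
  fixes \<mu> :: "'s::countable pmf"
  shows "(\<integral>\<^sup>+\<omega>. F (map \<omega> [0..<Suc n]) \<partial>path_law \<mu> P) = (\<integral>\<^sup>+xs. F xs \<partial>prefix_pmf \<mu> P n)"
  unfolding distr_prefix[symmetric] by (subst nn_integral_distr) simp_all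

text \<open>Dependence on the first \<open>n + 1\<close> coordinates alone makes
  \<open>\<phi>\<close> a function of a list-valued prefix, hence measurable; the claim is then the
  recursion of \<open>prefix_pmf\<close>.\<close>

lemma markov_property:
  fixes \<mu> :: "'s::countable pmf" and \<phi> :: "(nat \<Rightarrow> 's) \<Rightarrow> ennreal"
  assumes past: "\<And>\<omega> \<omega>'. (\<And>i. i \<le> n \<Longrightarrow> \<omega> i = \<omega>' i) \<Longrightarrow> \<phi> \<omega> = \<phi> \<omega>'"
  shows "(\<integral>\<^sup>+\<omega>. f (\<omega> (Suc n)) * \<phi> \<omega> \<partial>path_law \<mu> P) =
    (\<integral>\<^sup>+\<omega>. (\<integral>\<^sup>+t. f t \<partial>P (\<omega> n)) * \<phi> \<omega> \<partial>path_law \<mu> P)"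
proof -
  \<comment> \<open>\<open>nth xs\<close> serves as a path; by \<open>past\<close>, its values
    beyond the length of the list do not matter.\<close>
  define \<psi> where "\<psi> xs = \<phi> (nth xs)" for xs
  have \<psi>: "\<phi> \<omega> = \<psi> (map \<omega> [0..<Suc n])" for \<omega>
    unfolding \<psi>_def by (rule past) (simp add: less_Suc_eq_le del: upt_Suc)
  have "(\<integral>\<^sup>+\<omega>. f (\<omega> (Suc n)) * \<phi> \<omega> \<partial>path_law \<mu> P) =
      (\<integral>\<^sup>+\<omega>. (\<lambda>xs. f (last xs) * \<psi> (butlast xs)) (map \<omega> [0..<Suc (Suc n)]) \<partial>path_law \<mu> P)"
    by (intro nn_integral_cong) (simp add: \<psi> butlast_append)
  also have "\<dots> = (\<integral>\<^sup>+xs. f (last xs) * \<psi> (butlast xs) \<partial>prefix_pmf \<mu> P (Suc n))"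
    by (rule nn_integral_prefix)
  also have "\<dots> = (\<integral>\<^sup>+xs. (\<integral>\<^sup>+t. f t \<partial>P (last xs)) * \<psi> xs \<partial>prefix_pmf \<mu> P n)"
    by (simp add: nn_integral_bind_pmf nn_integral_multc)
  also have "\<dots> = (\<integral>\<^sup>+\<omega>. (\<lambda>xs. (\<integral>\<^sup>+t. f t \<partial>P (last xs)) * \<psi> xs) (map \<omega> [0..<Suc n]) \<partial>path_law \<mu> P)"
    by (rule nn_integral_prefix[symmetric])
  also have "\<dots> = (\<integral>\<^sup>+\<omega>. (\<integral>\<^sup>+t. f t \<partial>P (\<omega> n)) * \<phi> \<omega> \<partial>path_law \<mu> P)"
    by (intro nn_integral_cong) (simp add: \<psi>)
  finally show ?thesis .
qed

primrec marginal :: "'s pmf \<Rightarrow> ('s \<Rightarrow> 's pmf) \<Rightarrow> nat \<Rightarrow> 's pmf" where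
  "marginal \<mu> P 0 = \<mu>"
| "marginal \<mu> P (Suc n) = bind_pmf (marginal \<mu> P n) P"

lemma nn_integral_coordinate:
  fixes \<mu> :: "'s::countable pmf"
  shows "(\<integral>\<^sup>+\<omega>. f (\<omega> n) \<partial>path_law \<mu> P) = (\<integral>\<^sup>+s. f s \<partial>marginal \<mu> P n)"
proof (induction n arbitrary: f)
  case 0
  show ?case
    using nn_integral_prefix[where F = "\<lambda>xs. f (hd xs)" and n = 0 and \<mu> = \<mu> and P = P] by simp
next
  case (Suc n)
  show ?case
    using markov_property[where \<phi> = "\<lambda>_. 1" and n = n and f = f and \<mu> = \<mu> and P = P] Suc[of "\<lambda>s. \<integral>\<^sup>+t. f t \<partial>P s"]
    by (simp add: nn_integral_bind_pmf)
qed

section \<open>Staying in a set forever\<close>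

text \<open>Times 0 to \<open>n\<close> are constrained, so \<open>n + 1\<close> states. Iterating
  the kernel treats all starting states at once; \<open>emeasure_stay\<close> makes the link with
  paths.\<close>

primrec stay_upto :: "('s \<Rightarrow> 's pmf) \<Rightarrow> 's set \<Rightarrow> nat \<Rightarrow> 's \<Rightarrow> ennreal" where
  "stay_upto P C 0 = indicator C"
| "stay_upto P C (Suc n) = (\<lambda>s. indicator C s * (\<integral>\<^sup>+t. stay_upto P C n t \<partial>P s))"

definition stay :: "('s \<Rightarrow> 's pmf) \<Rightarrow> 's set \<Rightarrow> 's \<Rightarrow> ennreal" where
  "stay P C s = (INF n. stay_upto P C n s)"

lemma nn_integral_pmf_le_1: "(\<And>t. f t \<le> 1) \<Longrightarrow> (\<integral>\<^sup>+t. f t \<partial>measure_pmf \<nu>) \<le> 1"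
  using nn_integral_mono[of "measure_pmf \<nu>" f "\<lambda>_. 1"] by simp

lemma indicator_le_1_ennreal: "indicator C s \<le> (1 :: ennreal)"
  by (simp add: indicator_def)

lemma stay_upto_le_indicator: "stay_upto P C n s \<le> indicator C s"
proof (induction n arbitrary: s)
  case (Suc n)
  have "(\<integral>\<^sup>+t. stay_upto P C n t \<partial>P s) \<le> 1"
    using order_trans[OF Suc indicator_le_1_ennreal] by (rule nn_integral_pmf_le_1)
  then show ?case
    by (auto simp: indicator_def)
qed simp

lemma stay_upto_le_1: "stay_upto P C n s \<le> 1"
  using stay_upto_le_indicator indicator_le_1_ennreal by (rule order_trans)

lemma decseq_stay_upto: "decseq (stay_upto P C)"
proof (rule decseq_SucI)
  fix n
  show "stay_upto P C (Suc n) \<le> stay_upto P C n"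
  proof (induction n)
    case 0
    show ?case
      using stay_upto_le_indicator[of P C "Suc 0"] by (auto simp: le_fun_def)
  next
    case (Suc n)
    then show ?case
      by (auto simp: le_fun_def intro!: mult_left_mono nn_integral_mono)
  qed
qed

lemma stay_le_indicator: "stay P C s \<le> indicator C s"
  unfolding stay_def by (rule INF_lower2[of 0]) auto

lemma stay_le_1: "stay P C s \<le> 1"
  using stay_le_indicator indicator_le_1_ennreal by (rule order_trans)

lemma INF_mult_left_indicator:
  "(INF n::nat. indicator D s * f n) = (indicator D s :: ennreal) * (INF n. f n)"
  by (cases "s \<in> D") auto

lemma nn_integral_stay: "(\<integral>\<^sup>+t. stay P C t \<partial>measure_pmf \<nu>) = (INF n. \<integral>\<^sup>+t. stay_upto P C n t \<partial>\<nu>)"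
proof -
  have "(\<integral>\<^sup>+t. stay_upto P C 0 t \<partial>\<nu>) \<le> 1"
    using stay_upto_le_1 by (rule nn_integral_pmf_le_1)
  then have "(\<integral>\<^sup>+t. stay_upto P C 0 t \<partial>\<nu>) < \<infinity>"
    by (rule order.strict_trans1) simp
  then show ?thesis
    unfolding stay_def using decseq_stay_upto[of P C]
    by (intro nn_integral_monotone_convergence_INF_decseq[where i = 0]) auto
qed

text \<open>Dropping the first term of a decreasing sequence keeps its infimum, and monotone
  convergence moves the infimum under the kernel.\<close>

lemma stay_unfold: "stay P C s = indicator C s * (\<integral>\<^sup>+t. stay P C t \<partial>P s)"
proof -
  have "stay P C s = (INF n. stay_upto P C (Suc n) s)"
  proof (rule antisym)
    show "stay P C s \<le> (INF n. stay_upto P C (Suc n) s)"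
      unfolding stay_def by (intro INF_greatest INF_lower) auto
    show "(INF n. stay_upto P C (Suc n) s) \<le> stay P C s"
      unfolding stay_def
      using decseq_SucD[OF decseq_stay_upto[of P C]]
      by (intro INF_mono) (auto simp: le_fun_def simp del: stay_upto.simps)
  qed
  then show ?thesis
    by (simp add: INF_mult_left_indicator nn_integral_stay)
qed

text \<open>Coinduction: a subinvariant function bounded by 1 lies below every
  \<open>stay_upto P C n\<close>, by induction on \<open>n\<close>.\<close>

lemma le_stay:
  fixes P :: "'s \<Rightarrow> 's pmf"
  assumes "\<And>s. f s \<le> 1" "\<And>s. f s \<le> indicator C s * (\<integral>\<^sup>+t. f t \<partial>P s)"
  shows "f s \<le> stay P C s"
proof -
  have "f s \<le> stay_upto P C n s" for n
  proof (induction n arbitrary: s)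
    case 0
    show ?case
      using assms(1)[of s] assms(2)[of s] by (auto simp: indicator_def split: if_splits)
  next
    case (Suc n)
    have "f s \<le> indicator C s * (\<integral>\<^sup>+t. f t \<partial>P s)"
      by (rule assms)
    also have "\<dots> \<le> stay_upto P C (Suc n) s"
      using Suc by (auto intro!: mult_left_mono nn_integral_mono)
    finally show ?case .
  qed
  then show ?thesis
    unfolding stay_def by (rule INF_greatest)
qed

lemma emeasure_stay:
  fixes \<mu> :: "'s::countable pmf"
  shows "emeasure (path_law \<mu> P) {\<omega>. \<omega> m \<in> D \<and> (\<forall>j\<ge>m. \<omega> j \<in> C)} =
    (\<integral>\<^sup>+s. indicator D s * stay P C s \<partial>marginal \<mu> P m)"
proof -
  let ?E = "\<lambda>n. {\<omega>. \<omega> m \<in> D \<and> (\<forall>j\<in>{m..<m + n}. \<omega> j \<in> C)}"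
  let ?K = "\<lambda>f s. indicator C s * (\<integral>\<^sup>+t. f t \<partial>P s) :: ennreal"
  have sets: "?E n \<in> sets (path_law \<mu> P)" for n
  proof -
    have "?E n = {\<omega>. \<omega> m \<in> D} \<inter> (\<Inter>j\<in>{m..<m+n}. {\<omega>. \<omega> j \<in> C})" by auto
    then show ?thesis
      by (cases "n = 0") auto
  qed
  \<comment> \<open>With \<open>f\<close> arbitrary in the induction, each use of the Markov
    property consumes the last constraint and replaces \<open>f\<close> by
    \<open>?K f\<close>.\<close>
  have iter: "(\<integral>\<^sup>+\<omega>. f (\<omega> (m + n)) * indicator (?E n) \<omega> \<partial>path_law \<mu> P) =
      (\<integral>\<^sup>+s. indicator D s * (?K ^^ n) f s \<partial>marginal \<mu> P m)" for n f
  proof (induction n arbitrary: f)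
    case 0
    show ?case
      unfolding nn_integral_coordinate[symmetric] by (simp add: indicator_def mult.commute)
  next
    case (Suc n)
    have "(\<integral>\<^sup>+\<omega>. f (\<omega> (m + Suc n)) * indicator (?E (Suc n)) \<omega> \<partial>path_law \<mu> P) =
        (\<integral>\<^sup>+\<omega>. (\<integral>\<^sup>+t. f t \<partial>P (\<omega> (m + n))) * indicator (?E (Suc n)) \<omega> \<partial>path_law \<mu> P)"
      unfolding add_Suc_right by (rule markov_property) (auto simp: indicator_def)
    also have "\<dots> = (\<integral>\<^sup>+\<omega>. ?K f (\<omega> (m + n)) * indicator (?E n) \<omega> \<partial>path_law \<mu> P)"
      by (intro nn_integral_cong) (auto simp: indicator_def less_Suc_eq)
    also have "\<dots> = (\<integral>\<^sup>+s. indicator D s * (?K ^^ Suc n) f s \<partial>marginal \<mu> P m)"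
      using Suc[of "?K f"] by (simp only: funpow_Suc_right comp_def)
    finally show ?case .
  qed
  \<comment> \<open>\<open>?E (Suc n)\<close> constrains \<open>Suc n\<close> times, which matches
    the \<open>n + 1\<close> states counted by \<open>stay_upto P C n\<close>.\<close>
  have upto: "(?K ^^ Suc n) (\<lambda>_. 1) = stay_upto P C n" for n
    by (induction n) simp_all
  have "emeasure (path_law \<mu> P) (?E (Suc n)) = (\<integral>\<^sup>+s. indicator D s * stay_upto P C n s \<partial>marginal \<mu> P m)" for n
    using iter[of "\<lambda>_. 1" "Suc n"] sets[of "Suc n"] unfolding upto by simp
  moreover have "(INF n. emeasure (path_law \<mu> P) (?E (Suc n))) = emeasure (path_law \<mu> P) (\<Inter>n. ?E (Suc n))"
  proof (rule INF_emeasure_decseq')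
    interpret prob_space "path_law \<mu> P"
      by (rule prob_space_path_law)
    show "\<exists>n. emeasure (path_law \<mu> P) (?E (Suc n)) \<noteq> \<infinity>"
      by simp
  qed (rule sets, auto simp: decseq_def)
  moreover have "(\<Inter>n. ?E (Suc n)) = {\<omega>. \<omega> m \<in> D \<and> (\<forall>j\<ge>m. \<omega> j \<in> C)}"
    by (force simp: le_iff_add)
  moreover have "(\<integral>\<^sup>+s. indicator D s * stay P C s \<partial>marginal \<mu> P m) =
      (INF n. \<integral>\<^sup>+s. indicator D s * stay_upto P C n s \<partial>marginal \<mu> P m)"
  proof -
    have "(\<integral>\<^sup>+s. indicator D s * stay_upto P C 0 s \<partial>marginal \<mu> P m) \<le> 1"
      by (rule nn_integral_pmf_le_1) (auto simp: indicator_def)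
    then have "(\<integral>\<^sup>+s. indicator D s * stay_upto P C 0 s \<partial>marginal \<mu> P m) < \<infinity>"
      by (rule order.strict_trans1) simp
    then show ?thesis
      unfolding stay_def INF_mult_left_indicator[symmetric] using decseq_stay_upto[of P C]
      by (intro nn_integral_monotone_convergence_INF_decseq[where i = 0])
        (auto simp: monotone_on_def le_fun_def intro!: mult_left_mono)
  qed
  ultimately show ?thesis
    by simp
qed

text \<open>Staying in \<open>C\<close> means first staying in \<open>D\<close> up to time
  \<open>n\<close>, after which the remaining chance is at most the supremum \<open>c\<close>. For
  each \<open>s\<close> in \<open>C\<close> some \<open>n\<close> makes the first factor less than
  1/2.\<close>

lemma stay_eq_0:
  assumes "C \<subseteq> D" and half: "\<And>s. s \<in> C \<Longrightarrow> stay P D s < ennreal (1 / 2)"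
  shows "stay P C s = 0"
proof -
  define c where "c = (SUP s. stay P C s)"
  have le_c: "stay P C s \<le> c" for s
    unfolding c_def by (rule SUP_upper) simp
  have "c \<le> 1"
    unfolding c_def by (rule SUP_least) (rule stay_le_1)
  have le: "stay P C s \<le> c * stay_upto P D n s" for n s
  proof (induction n arbitrary: s)
    case 0
    show ?case
      using le_c[of s] stay_le_indicator[of P C s] \<open>C \<subseteq> D\<close>
      by (cases "s \<in> C") auto
  next
    case (Suc n)
    have "stay P C s \<le> indicator D s * (\<integral>\<^sup>+t. stay P C t \<partial>P s)"
      using \<open>C \<subseteq> D\<close> by (subst stay_unfold) (auto simp: indicator_def)
    also have "\<dots> \<le> indicator D s * (\<integral>\<^sup>+t. c * stay_upto P D n t \<partial>P s)"
      using Suc by (intro mult_left_mono nn_integral_mono) auto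
    also have "\<dots> = c * stay_upto P D (Suc n) s"
      by (simp add: nn_integral_cmult ac_simps)
    finally show ?case .
  qed
  have "stay P C s \<le> c * ennreal (1 / 2)" for s
  proof (cases "s \<in> C")
    case True
    then obtain n where "stay_upto P D n s < ennreal (1 / 2)"
      using half unfolding stay_def by (auto simp: INF_less_iff)
    then show ?thesis
      using le[of s n] by (meson mult_left_mono order.trans less_imp_le zero_le)
  next
    case False
    then show ?thesis
      using stay_le_indicator[of P C s] by simp
  qed
  then have "c \<le> c * ennreal (1 / 2)"
    unfolding c_def by (intro SUP_least) simp
  \<comment> \<open>Finiteness of \<open>c\<close> matters: infinity satisfies the same
    inequality.\<close>
  then have "c = 0"
    using \<open>c \<le> 1\<close> 
  proof (cases c)
    case (real r)
    have "c * ennreal (1 / 2) = ennreal (r * (1 / 2))"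
      using real by (simp add: ennreal_mult[of r "1 / 2"] del: ennreal_half times_divide_eq_right)
    then show ?thesis
      using \<open>c \<le> c * ennreal (1 / 2)\<close> real by (simp add: ennreal_le_iff)
  qed (auto simp: top_unique)
  then show ?thesis
    using le_c[of s] by simp
qed

section \<open>A ranking function with finite sublevel sets\<close>

text \<open>\<open>escape P C N s\<close> is the probability of hitting \<open>{t \<in> C. N \<le> to_nat t}\<close> before leaving \<open>C\<close>.\<close>

definition escape :: "('s::countable \<Rightarrow> 's pmf) \<Rightarrow> 's set \<Rightarrow> nat \<Rightarrow> 's \<Rightarrow> ennreal" where
  "escape P C N = lfp (\<lambda>f s. if s \<notin> C then 0 else if N \<le> to_nat s then 1 else \<integral>\<^sup>+t. f t \<partial>P s)"

lemma escape_unfold: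
  "escape P C N s = (if s \<notin> C then 0 else if N \<le> to_nat s then 1 else \<integral>\<^sup>+t. escape P C N t \<partial>P s)"
proof -
  have "mono (\<lambda>f s. if s \<notin> C then 0 else if N \<le> to_nat s then 1 else \<integral>\<^sup>+t. f t \<partial>P s :: ennreal)"
    by (auto simp: mono_def le_fun_def intro!: nn_integral_mono)
  from fun_cong[OF lfp_unfold[OF this], of s] show ?thesis
    unfolding escape_def .
qed

lemma escape_le_1: "escape P C N s \<le> 1"
proof -
  have "escape P C N \<le> (\<lambda>_. 1)"
    unfolding escape_def by (rule lfp_lowerbound) (auto simp: le_fun_def)
  then show ?thesis
    by (auto simp: le_fun_def)
qed

text \<open>For \<open>M \<le> N\<close>, \<open>escape P C M\<close> is a prefixed point of the
  functional with threshold \<open>N\<close>: between the two thresholds its value on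
  \<open>C\<close> is 1, which dominates its own mean.\<close>

lemma decseq_escape: "decseq (escape P C)"
  unfolding decseq_def
proof (intro allI impI)
  fix M N :: nat assume "M \<le> N"
  show "escape P C N \<le> escape P C M"
    unfolding escape_def[of P C N]
  proof (rule lfp_lowerbound, rule le_funI)
    fix s
    show "(if s \<notin> C then 0 else if N \<le> to_nat s then 1 else \<integral>\<^sup>+t. escape P C M t \<partial>P s) \<le> escape P C M s"
      using \<open>M \<le> N\<close> nn_integral_pmf_le_1[OF escape_le_1[of P C M], of "P s"]
      by (subst (2) escape_unfold) auto
  qed
qed

text \<open>Supermartingale property on all of \<open>C\<close>: equality below the threshold, and
  the trivial bound 1 from there on.\<close>

lemma nn_integral_escape_le:
  fixes P :: "'s::countable \<Rightarrow> 's pmf"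
  shows "s \<in> C \<Longrightarrow> (\<integral>\<^sup>+t. escape P C N t \<partial>P s) \<le> escape P C N s"
  using nn_integral_pmf_le_1[OF escape_le_1[of P C N], of "P s"]
  by (subst (2) escape_unfold) auto

text \<open>The limit of \<open>escape P C N s\<close> as \<open>N\<close> grows is invariant under the kernel on all of \<open>C\<close>, since
  each single state eventually falls below the threshold.\<close>

lemma INF_escape_le_stay: "(INF N. escape P C N s) \<le> stay P C s"
proof (rule le_stay)
  fix s
  show "(INF N. escape P C N s) \<le> 1"
    by (rule INF_lower2[of 0]) (auto simp: escape_le_1)
  show "(INF N. escape P C N s) \<le> indicator C s * (\<integral>\<^sup>+t. (INF N. escape P C N t) \<partial>P s)"
  proof (cases "s \<in> C")
    case True
    have "(\<integral>\<^sup>+t. escape P C 0 t \<partial>P s) < \<infinity>"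
      using nn_integral_pmf_le_1[OF escape_le_1[of P C 0], of "P s"] by (rule order.strict_trans1) simp
    then have "(\<integral>\<^sup>+t. (INF N. escape P C N t) \<partial>P s) = (INF N. \<integral>\<^sup>+t. escape P C N t \<partial>P s)"
      using decseq_escape[of P C] by (intro nn_integral_monotone_convergence_INF_decseq[where i = 0]) auto
    moreover have "(INF N. escape P C N s) \<le> (\<integral>\<^sup>+t. escape P C N t \<partial>P s)" for N
    proof -
      define M where "M = max N (Suc (to_nat s))"
      have "(INF N. escape P C N s) \<le> escape P C M s"
        by (rule INF_lower) simp
      also have "\<dots> = (\<integral>\<^sup>+t. escape P C M t \<partial>P s)"
        using True by (subst escape_unfold) (auto simp: M_def)
      also have "\<dots> \<le> (\<integral>\<^sup>+t. escape P C N t \<partial>P s)"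
        using decseqD[OF decseq_escape[of P C], of N M]
        by (intro nn_integral_mono) (auto simp: M_def le_fun_def)
      finally show ?thesis .
    qed
    ultimately show ?thesis
      using True by (auto intro: INF_greatest)
  next
    case False
    then have "escape P C 0 s = 0"
      by (subst escape_unfold) simp
    then have "(INF N. escape P C N s) \<le> 0"
      by (metis INF_lower UNIV_I)
    then show ?thesis by simp
  qed
qed

text \<open>\<open>discount P C s\<close> is \<open>1 - E\<^sub>s(2\<^sup>-\<^sup>\<tau>)\<close> for the exit time \<open>\<tau>\<close> of \<open>C\<close>.\<close>

definition discount :: "('s \<Rightarrow> 's pmf) \<Rightarrow> 's set \<Rightarrow> 's \<Rightarrow> ennreal" where
  "discount P C = lfp (\<lambda>f s. if s \<in> C then (1 + (\<integral>\<^sup>+t. f t \<partial>P s)) / 2 else 0)"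

lemma discount_unfold:
  "discount P C s = (if s \<in> C then (1 + (\<integral>\<^sup>+t. discount P C t \<partial>P s)) / 2 else 0)"
proof -
  have "mono (\<lambda>f s. if s \<in> C then (1 + (\<integral>\<^sup>+t. f t \<partial>P s)) / 2 else 0 :: ennreal)"
    by (auto simp: mono_def le_fun_def intro!: nn_integral_mono divide_right_mono_ennreal add_left_mono)
  from fun_cong[OF lfp_unfold[OF this], of s] show ?thesis
    unfolding discount_def .
qed

lemma discount_le_1: "discount P C s \<le> 1"
proof -
  have "discount P C \<le> (\<lambda>_. 1)"
    unfolding discount_def by (rule lfp_lowerbound) (auto simp: le_fun_def)
  then show ?thesis
    by (auto simp: le_fun_def)
qed

text \<open>The states with \<open>discount\<close> equal to 1 lie in \<open>C\<close> and almost
  surely lead only to such states, so their indicator is subinvariant and \<open>le_stay\<close>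
  applies.\<close>

lemma nn_integral_discount_eq_1:
  fixes P :: "'s \<Rightarrow> 's pmf"
  assumes "s \<in> C" "(\<integral>\<^sup>+t. discount P C t \<partial>P s) = 1"
  shows "stay P C s = 1"
proof -
  have one: "(\<integral>\<^sup>+t. discount P C t \<partial>P s) = 1" if "discount P C s = 1" "s \<in> C" for s
  proof -
    let ?x = "\<integral>\<^sup>+t. discount P C t \<partial>P s"
    have "(1 + ?x) / 2 = 1" "?x \<le> 1"
      using that discount_unfold[of P C s] nn_integral_pmf_le_1[OF discount_le_1[of P C], of "P s"] by auto
    then show ?thesis
      by (cases ?x) (auto simp: top_unique ennreal_divide_numeral ennreal_plus[symmetric] ennreal_1[symmetric]
          simp del: ennreal_plus ennreal_1)
  qed
  have "indicator {s. discount P C s = 1} s \<le> stay P C s"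
  proof (rule le_stay)
    fix s
    show "indicator {s. discount P C s = 1} s \<le> indicator C s * (\<integral>\<^sup>+t. indicator {s. discount P C s = 1} t \<partial>P s)"
    proof (cases "discount P C s = 1")
      case True
      then have "s \<in> C"
        using discount_unfold[of P C s] by (auto split: if_splits)
      with True have "(\<integral>\<^sup>+t. discount P C t \<partial>P s) = 1"
        by (rule one)
      then have "(\<integral>\<^sup>+t. 1 - discount P C t \<partial>P s) = 0"
        by (subst nn_integral_diff) (auto simp: discount_le_1)
      then have "AE t in P s. discount P C t = 1"
        by (subst (asm) nn_integral_0_iff_AE)
          (auto simp: diff_eq_0_iff_ennreal intro: antisym discount_le_1 elim!: eventually_mono)
      then have "(\<integral>\<^sup>+t. indicator {s. discount P C s = 1} t \<partial>P s) = (\<integral>\<^sup>+t. 1 \<partial>P s)"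
        by (intro nn_integral_cong_AE) auto
      then show ?thesis
        using \<open>s \<in> C\<close> by (simp add: indicator_def)
    qed simp
  qed (rule indicator_le_1_ennreal)
  moreover have "discount P C s = 1"
    using assms by (subst discount_unfold) simp
  ultimately show ?thesis
    using stay_le_1[of P C s] by (intro antisym) simp_all
qed

text \<open>\<open>discount P C s\<close> is the midpoint of 1 and the mean \<open>?x\<close>, so it
  exceeds \<open>?x\<close> unless \<open>?x = 1\<close>.\<close>

lemma nn_integral_discount_less:
  fixes P :: "'s \<Rightarrow> 's pmf"
  assumes "s \<in> C" "stay P C s \<noteq> 1"
  shows "(\<integral>\<^sup>+t. discount P C t \<partial>P s) < discount P C s"
proof -
  let ?x = "\<integral>\<^sup>+t. discount P C t \<partial>P s"
  have "?x \<le> 1" "?x \<noteq> 1"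
    using nn_integral_discount_eq_1[OF assms(1)] assms(2)
      nn_integral_pmf_le_1[OF discount_le_1[of P C], of "P s"] by auto
  then have "?x < (1 + ?x) / 2"
    by (cases ?x) (auto simp: top_unique ennreal_divide_numeral ennreal_plus[symmetric] ennreal_1[symmetric] ennreal_less_iff
          simp del: ennreal_plus ennreal_1)
  then show ?thesis
    using assms(1) by (subst discount_unfold) simp
qed

lemma strict_ranking_with_finite_sublevels:
  fixes P :: "'s::countable \<Rightarrow> 's pmf"
  assumes closed: "\<And>s. s \<in> I \<Longrightarrow> set_pmf (P s) \<subseteq> I"
    and leaves: "\<And>s. s \<in> I \<Longrightarrow> stay P C s = 0"
  obtains W :: "'s \<Rightarrow> real"
  where "\<And>s. 0 \<le> W s" "\<And>s. s \<notin> C \<Longrightarrow> W s = 0" "\<And>s. s \<in> I \<inter> C \<Longrightarrow> 0 < W s"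
    "\<And>s. s \<in> I \<inter> C \<Longrightarrow> pmf_int (P s) W < ennreal (W s)"
    "\<And>r. finite {s \<in> I \<inter> C. W s \<le> r}"
proof -
  \<comment> \<open>One threshold per \<open>j\<close> serves the finitely many states of index at
    most \<open>j\<close>; for a fixed \<open>s\<close> the bound then holds from
    \<open>j = to_nat s\<close> on.\<close>
  have "\<exists>N. \<forall>s\<in>I. to_nat s \<le> j \<longrightarrow> escape P C N s \<le> ennreal ((1 / 2) ^ j)" for j
  proof -
    let ?K = "{s \<in> I. to_nat s \<le> j}"
    have "finite (to_nat -` {..j} :: 's set)"
      by (intro finite_vimageI) auto
    then have fin: "finite ?K"
      by (rule rev_finite_subset) auto
    have ex: "\<exists>N. escape P C N s < ennreal ((1 / 2) ^ j)" if "s \<in> ?K" for s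
    proof -
      have "(INF N. escape P C N s) < ennreal ((1 / 2) ^ j)"
        using INF_escape_le_stay[of P C s] leaves[of s] that by simp
      then show ?thesis
        by (auto simp: INF_less_iff)
    qed
    define n where "n s = (LEAST N. escape P C N s < ennreal ((1 / 2) ^ j))" for s
    have n: "escape P C (n s) s < ennreal ((1 / 2) ^ j)" if "s \<in> ?K" for s
      unfolding n_def using ex[OF that] by (rule LeastI_ex)
    \<comment> \<open>The sum of the individual thresholds stands in for their maximum, as
      \<open>escape\<close> decreases in the threshold.\<close>
    have "escape P C (sum n ?K) s \<le> ennreal ((1 / 2) ^ j)" if "s \<in> ?K" for s
    proof -
      have "n s \<le> sum n ?K"
        using that fin by (intro member_le_sum) auto
      then have "escape P C (sum n ?K) s \<le> escape P C (n s) s"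
        using decseqD[OF decseq_escape[of P C]] by (auto simp: le_fun_def)
      then show ?thesis
        using n[OF that] by simp
    qed
    then show ?thesis by blast
  qed
  then obtain N where N: "\<And>j s. s \<in> I \<Longrightarrow> to_nat s \<le> j \<Longrightarrow> escape P C (N j) s \<le> ennreal ((1 / 2) ^ j)"
    by metis
  define S where "S s = (\<Sum>j. escape P C (N j) s)" for s
  define X where "X s = S s + discount P C s" for s
  \<comment> \<open>Off \<open>I\<close> the value \<open>X s\<close> may be infinite and is then
    sent to 0. The drift is computed only from states of \<open>I\<close>, whose successors stay in
    \<open>I\<close>.\<close>
  define W where "W s = enn2real (X s)" for s
  have S_finite: "S s < top" if "s \<in> I" for s
  proof -
    \<comment> \<open>The terms before \<open>to_nat s\<close> have only the bound 1; the others are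
      dominated geometrically.\<close>
    define b :: "nat \<Rightarrow> real" where "b j = (1 / 2) ^ j + (if j < to_nat s then 1 else 0)" for j
    have "summable (\<lambda>j. if j < to_nat s then 1 else 0 :: real)"
      using summable_If_finite[of "\<lambda>j. j < to_nat s" "\<lambda>_. 1::real"] by simp
    then have "summable b"
      unfolding b_def by (intro summable_add summable_geometric) auto
    have "escape P C (N j) s \<le> ennreal (b j)" for j
    proof (cases "j < to_nat s")
      case True
      have "ennreal 1 \<le> ennreal (b j)"
        using True by (intro ennreal_leI) (simp add: b_def)
      then show ?thesis
        unfolding ennreal_1 by (rule order_trans[OF escape_le_1])
    next
      case False
      then show ?thesis
        using N[OF that, of j] by (simp add: b_def)
    qed
    then have "S s \<le> (\<Sum>j. ennreal (b j))"
      unfolding S_def by (intro suminf_le) auto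
    also have "\<dots> = ennreal (suminf b)"
      using _ \<open>summable b\<close> by (rule suminf_ennreal2) (simp add: b_def)
    finally show ?thesis
      by (rule order.strict_trans1) simp
  qed
  have X_finite: "X s < top" if "s \<in> I" for s
    using S_finite[OF that] order.strict_trans1[OF discount_le_1[of P C s], of top] by (simp add: X_def)
  have W: "ennreal (W s) = X s" if "s \<in> I" for s
    using X_finite[OF that] by (simp add: W_def)
  have disc: "discount P C s \<noteq> 0" if "s \<in> C" for s
    using that by (subst discount_unfold) (simp add: ennreal_divide_eq_0_iff)
  show thesis
  proof
    show "0 \<le> W s" for s
      by (simp add: W_def)
    show "W s = 0" if "s \<notin> C" for s
      using that escape_unfold[of P C _ s] discount_unfold[of P C s] by (simp add: W_def X_def S_def)
    show "0 < W s" if "s \<in> I \<inter> C" for s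
    proof -
      have "ennreal (W s) \<noteq> 0"
        using that disc[of s] by (simp add: W X_def)
      then show ?thesis
        by (simp add: ennreal_eq_0_iff)
    qed
    show "pmf_int (P s) W < ennreal (W s)" if "s \<in> I \<inter> C" for s
    proof -
      have "pmf_int (P s) W = (\<integral>\<^sup>+t. X t \<partial>P s)"
        unfolding pmf_int_def using closed[of s] that
        by (intro nn_integral_cong_AE) (auto simp: AE_measure_pmf_iff W)
      also have "\<dots> = (\<Sum>j. \<integral>\<^sup>+t. escape P C (N j) t \<partial>P s) + (\<integral>\<^sup>+t. discount P C t \<partial>P s)"
        unfolding X_def S_def by (subst nn_integral_add) (auto simp: nn_integral_suminf)
      also have "\<dots> \<le> S s + (\<integral>\<^sup>+t. discount P C t \<partial>P s)"
        unfolding S_def using that by (intro add_right_mono suminf_le nn_integral_escape_le) auto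
      also have "\<dots> < S s + discount P C s"
        using nn_integral_discount_less[of s C P] leaves[of s] S_finite[of s] that
        by (simp add: ennreal_add_left_cancel_less)
      finally show ?thesis
        using that by (simp add: W X_def)
    qed
    show "finite {s \<in> I \<inter> C. W s \<le> r}" for r
    proof -
      obtain m :: nat where m: "r < real m"
        using reals_Archimedean2 by blast
      \<comment> \<open>An index beyond the first \<open>m\<close> thresholds makes the first
        \<open>m\<close> terms of \<open>S s\<close> equal to 1, so \<open>W s\<close> is at least
        \<open>m > r\<close>.\<close>
      have "to_nat s < (\<Sum>j<m. N j)" if s: "s \<in> I \<inter> C" "W s \<le> r" for s
      proof (rule ccontr)
        assume "\<not> to_nat s < (\<Sum>j<m. N j)"
        then have "N j \<le> to_nat s" if "j < m" for j
          using member_le_sum[of j "{..<m}" N] that by auto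
        then have "escape P C (N j) s = 1" if "j < m" for j
          using s that by (subst escape_unfold) auto
        then have "ennreal (real m) = (\<Sum>j<m. escape P C (N j) s)"
          by (simp add: ennreal_of_nat_eq_real_of_nat)
        also have "\<dots> \<le> S s"
          unfolding S_def by (intro sum_le_suminf) auto
        also have "\<dots> \<le> ennreal (W s)"
          using s by (simp add: W X_def)
        finally have "real m \<le> W s"
          by (subst (asm) ennreal_le_iff) (auto simp: W_def)
        with m s show False by simp
      qed
      then have "{s \<in> I \<inter> C. W s \<le> r} \<subseteq> to_nat -` {..<\<Sum>j<m. N j}"
        by auto
      then show ?thesis
        by (rule finite_subset) (intro finite_vimageI, auto)
    qed
  qed
qed

text \<open>The minimum of \<open>e\<close> over a sublevel set can only drop as the set grows with
  \<open>r\<close>. Inserting 1 covers empty sublevel sets and gives the bound required of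
  probabilities.\<close>

lemma antimono_lower_bound:
  fixes W e :: "'s \<Rightarrow> real"
  assumes "\<And>r. finite {s \<in> K. W s \<le> r}" "\<And>s. s \<in> K \<Longrightarrow> 0 < e s"
  shows "\<exists>d :: real \<Rightarrow> real. (\<forall>r. 0 < d r \<and> d r \<le> 1) \<and> antimono d \<and> (\<forall>s\<in>K. d (W s) \<le> e s)"
proof (intro exI conjI allI ballI)
  let ?d = "\<lambda>r. Min (insert 1 (e ` {s \<in> K. W s \<le> r}))"
  show "0 < ?d r" "?d r \<le> 1" for r
    using assms by auto
  show "antimono ?d"
  proof (rule antimonoI)
    fix x y :: real assume "x \<le> y"
    then show "?d y \<le> ?d x"
      using assms(1) by (intro Min_antimono) auto
  qed
  show "?d (W s) \<le> e s" if "s \<in> K" for s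
    using assms(1) that by (intro Min_le) auto
qed

lemma ex_smaller_successor:
  assumes "pmf_int \<nu> W < ennreal w"
  shows "\<exists>t\<in>set_pmf \<nu>. W t < w"
proof (rule ccontr)
  assume "\<not> ?thesis"
  then have "(\<integral>\<^sup>+t. ennreal w \<partial>\<nu>) \<le> pmf_int \<nu> W"
    unfolding pmf_int_def by (intro nn_integral_mono_AE) (auto simp: AE_measure_pmf_iff not_less ennreal_leI)
  with assms show False
    by simp
qed

section \<open>Certificates for Streett conditions\<close>

text \<open>Collects the conditions on a single pair, so that the pairs can be treated separately
  over a common \<open>I\<close>.\<close>

definition streett_certificate ::
  "('s \<Rightarrow> 's pmf) \<Rightarrow> 's set \<Rightarrow> 's set \<Rightarrow> 's set \<Rightarrow> 's set \<Rightarrow> ('s \<Rightarrow> real) \<Rightarrow> ('s \<Rightarrow> real) \<Rightarrow>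
     (real \<Rightarrow> real) \<Rightarrow> (real \<Rightarrow> real) \<Rightarrow> bool" where
  "streett_certificate P I A B J V W d p \<longleftrightarrow>
      J \<subseteq> I - A \<and>
      (\<forall>s. 0 \<le> V s) \<and> (\<forall>s. 0 \<le> W s) \<and>
      (\<forall>r\<ge>0. 0 < d r) \<and> (\<forall>r\<ge>0. 0 < p r \<and> p r \<le> 1) \<and>
      (\<forall>s. s \<notin> A \<longrightarrow> pmf_int (P s) V \<le> ennreal (V s)) \<and>
      (\<forall>s\<in>A. 1 \<le> V s) \<and>
      (\<exists>\<gamma>>0. \<forall>s\<in>J. V s \<le> 1 - \<gamma>) \<and>
      (\<forall>s\<in>I - (B \<union> J). 0 < W s \<and> pmf_int (P s) W \<le> ennreal (W s)) \<and>
      (\<forall>s\<in>I \<inter> (B \<union> J). W s = 0) \<and>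
      (\<forall>r>0. \<forall>s\<in>I - (B \<union> J). W s = r \<longrightarrow>
         p r \<le> measure_pmf.prob (P s) {s'. W s' \<le> r - d r}) \<and>
      antimono_on {0<..} p \<and> antimono_on {0<..} d"

text \<open>The Streett condition enters only through \<open>leaves\<close>: it makes the exit from
  \<open>C\<close> almost sure, as the ranking \<open>W\<close> requires.\<close>

lemma streett_pair_certificate:
  fixes P :: "'s::countable \<Rightarrow> 's pmf"
  assumes closed: "\<And>s. s \<in> I \<Longrightarrow> set_pmf (P s) \<subseteq> I"
    and leaves: "\<And>s. s \<in> I \<Longrightarrow> stay P {s. s \<notin> B \<and> stay P (- A) s < ennreal (1 / 2)} s = 0"
  shows "\<exists>J V W d p. streett_certificate P I A B J V W d p"
proof -
  \<comment> \<open>In terms of \<open>V\<close> below this is \<open>{V > 1/2} - B\<close>; inside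
    \<open>I\<close> it is the complement of \<open>B \<union> J\<close>.\<close>
  define C where "C = {s. s \<notin> B \<and> stay P (- A) s < ennreal (1 / 2)}"
  define J where "J = {s \<in> I. ennreal (1 / 2) \<le> stay P (- A) s}"
  define V where "V s = 1 - enn2real (stay P (- A) s)" for s
  have IC: "I - (B \<union> J) = I \<inter> C" "I \<inter> (B \<union> J) \<inter> C = {}"
    by (auto simp: C_def J_def not_le)
  have V: "ennreal (V s) = 1 - stay P (- A) s" for s
    using stay_le_1[of P "- A" s] by (cases "stay P (- A) s") (auto simp: V_def top_unique ennreal_minus[symmetric])
  have A0: "stay P (- A) s = 0" if "s \<in> A" for s
    using that stay_le_indicator[of P "- A" s] by simp
  obtain W :: "'s \<Rightarrow> real" where W: "\<And>s. 0 \<le> W s" "\<And>s. s \<notin> C \<Longrightarrow> W s = 0"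
      "\<And>s. s \<in> I \<inter> C \<Longrightarrow> 0 < W s" "\<And>s. s \<in> I \<inter> C \<Longrightarrow> pmf_int (P s) W < ennreal (W s)"
    and sublevel: "\<And>r. finite {s \<in> I \<inter> C. W s \<le> r}"
    using strict_ranking_with_finite_sublevels[OF closed leaves, folded C_def] by blast
  \<comment> \<open>A single successor \<open>t s\<close> witnesses the decrease: \<open>d\<close>
    bounds its drop in \<open>W\<close> from below, and \<open>p\<close> its transition
    probability.\<close>
  obtain t where t: "\<And>s. s \<in> I \<inter> C \<Longrightarrow> t s \<in> set_pmf (P s) \<and> W (t s) < W s"
    using ex_smaller_successor[OF W(4)] by metis
  have pos: "0 < W s - W (t s)" "0 < pmf (P s) (t s)" if "s \<in> I \<inter> C" for s
    using t[OF that] by (auto simp: pmf_positive)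
  obtain d :: "real \<Rightarrow> real" where d: "\<forall>r. 0 < d r \<and> d r \<le> 1" "antimono d"
      "\<forall>s\<in>I \<inter> C. d (W s) \<le> W s - W (t s)"
    using antimono_lower_bound[of "I \<inter> C" W "\<lambda>s. W s - W (t s)", OF sublevel pos(1)] by blast
  obtain p :: "real \<Rightarrow> real" where p: "\<forall>r. 0 < p r \<and> p r \<le> 1" "antimono p"
      "\<forall>s\<in>I \<inter> C. p (W s) \<le> pmf (P s) (t s)"
    using antimono_lower_bound[of "I \<inter> C" W "\<lambda>s. pmf (P s) (t s)", OF sublevel pos(2)] by blast
  have "J \<subseteq> I - A"
    using A0 by (auto simp: J_def)
  moreover have "\<forall>s. 0 \<le> V s"
    using stay_le_1[of P "- A"] by (auto simp: V_def enn2real_leI)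
  moreover have "\<forall>s. s \<notin> A \<longrightarrow> pmf_int (P s) V \<le> ennreal (V s)"
  proof (intro allI impI)
    fix s assume "s \<notin> A"
    have "pmf_int (P s) V = (\<integral>\<^sup>+t. 1 - stay P (- A) t \<partial>P s)"
      unfolding pmf_int_def V ..
    also have "\<dots> = 1 - (\<integral>\<^sup>+t. stay P (- A) t \<partial>P s)"
      using neq_top_trans[OF ennreal_one_neq_top nn_integral_pmf_le_1[OF stay_le_1]]
      by (subst nn_integral_diff) (simp_all add: stay_le_1)
    \<comment> \<open>Off \<open>A\<close> the indicator in \<open>stay_unfold\<close> is 1, so
      \<open>V\<close> is even harmonic there.\<close>
    also have "\<dots> = 1 - stay P (- A) s"
      using \<open>s \<notin> A\<close> by (subst (2) stay_unfold) simp
    finally show "pmf_int (P s) V \<le> ennreal (V s)"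
      by (simp add: V)
  qed
  moreover have "\<forall>s\<in>A. 1 \<le> V s"
    by (simp add: V_def A0)
  moreover have "\<exists>\<gamma>>0. \<forall>s\<in>J. V s \<le> 1 - \<gamma>"
  proof (intro exI[of _ "1 / 2"] conjI ballI)
    fix s assume "s \<in> J"
    then have "ennreal (1 / 2) \<le> stay P (- A) s"
      by (simp add: J_def)
    then have "enn2real (ennreal (1 / 2)) \<le> enn2real (stay P (- A) s)"
      by (rule enn2real_mono) (rule order.strict_trans1[OF stay_le_1], simp)
    then show "V s \<le> 1 - 1 / 2"
      by (simp add: V_def del: ennreal_half)
  qed simp
  moreover have "\<forall>s. 0 \<le> W s" "\<forall>r\<ge>0. 0 < d r" "\<forall>r\<ge>0. 0 < p r \<and> p r \<le> 1"
    using W(1) d(1) p(1) by blast+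
  moreover have "\<forall>s\<in>I - (B \<union> J). 0 < W s \<and> pmf_int (P s) W \<le> ennreal (W s)"
    unfolding IC(1) using W(3,4) less_imp_le by blast
  moreover have "\<forall>r>0. \<forall>s\<in>I - (B \<union> J). W s = r \<longrightarrow>
      p r \<le> measure_pmf.prob (P s) {s'. W s' \<le> r - d r}"
    unfolding IC(1)
  proof (intro allI ballI impI)
    fix r s assume "s \<in> I \<inter> C" "W s = r"
    note that = this
    have "p r \<le> measure_pmf.prob (P s) {t s}"
      using bspec[OF p(3) that(1)] that(2) by (simp add: measure_pmf_single)
    also have "\<dots> \<le> measure_pmf.prob (P s) {s'. W s' \<le> r - d r}"
      using bspec[OF d(3) that(1)] that(2) by (intro measure_pmf.finite_measure_mono) auto
    finally show "p r \<le> measure_pmf.prob (P s) {s'. W s' \<le> r - d r}" .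
  qed
  moreover have "\<forall>s\<in>I \<inter> (B \<union> J). W s = 0"
    using W(2) IC(2) by blast
  moreover have "antimono_on {0<..} p" "antimono_on {0<..} d"
    using d(2) p(2) by (auto simp: monotone_on_def)
  ultimately show ?thesis
    unfolding streett_certificate_def
    by - (rule exI[of _ J], rule exI[of _ V], rule exI[of _ W], rule exI[of _ d], rule exI[of _ p], intro conjI)
qed

text \<open>A path that stays in \<open>?C\<close> misses \<open>B\<close>, so by the Streett
  condition it eventually misses \<open>A\<close> too and ends up in \<open>?C - A\<close>, which
  has probability zero.\<close>

lemma stay_eq_0_of_streett:
  fixes \<mu> :: "'s::countable pmf"
  assumes streett: "AE \<omega> in path_law \<mu> P. \<omega> \<in> fin_often A \<union> inf_often B"
    and s: "s \<in> set_pmf (marginal \<mu> P m)"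
  shows "stay P {s. s \<notin> B \<and> stay P (- A) s < ennreal (1 / 2)} s = 0"
proof -
  let ?C = "{s. s \<notin> B \<and> stay P (- A) s < ennreal (1 / 2)}"
  have 0: "stay P (?C - A) t = 0" for t
    by (rule stay_eq_0[of _ "- A"]) auto
  have sets: "{\<omega>. \<forall>j\<ge>n. \<omega> j \<in> D} \<in> sets (path_law \<mu> P)" for n D
  proof -
    have "{\<omega>. \<forall>j\<ge>n. \<omega> j \<in> D} = (\<Inter>j\<in>{n..}. {\<omega>. \<omega> j \<in> D})"
      by auto
    then show ?thesis
      by (simp add: sets.countable_INT')
  qed
  \<comment> \<open>The time after which \<open>A\<close> is avoided depends on the path, so all
    \<open>n\<close> are excluded at once by a countable union of null sets.\<close>
  have "AE \<omega> in path_law \<mu> P. \<forall>n. \<not> (\<forall>j\<ge>n. \<omega> j \<in> ?C - A)"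
  proof (subst AE_all_countable, intro allI)
    fix n
    have "emeasure (path_law \<mu> P) {\<omega>. \<forall>j\<ge>n. \<omega> j \<in> ?C - A} = 0"
      using emeasure_stay[of \<mu> P n UNIV "?C - A"] unfolding 0 by simp
    then show "AE \<omega> in path_law \<mu> P. \<not> (\<forall>j\<ge>n. \<omega> j \<in> ?C - A)"
      using sets[of n "?C - A"] by (intro AE_I'[of "{\<omega>. \<forall>j\<ge>n. \<omega> j \<in> ?C - A}"]) (auto simp: null_setsI)
  qed
  with streett have "AE \<omega> in path_law \<mu> P. \<not> (\<omega> m \<in> {s} \<and> (\<forall>j\<ge>m. \<omega> j \<in> ?C))"
  proof eventually_elim
    case (elim \<omega>)
    show ?case
    proof
      assume C: "\<omega> m \<in> {s} \<and> (\<forall>j\<ge>m. \<omega> j \<in> ?C)"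
      then have "\<omega> \<notin> inf_often B"
        by (auto simp: inf_often_def)
      with elim(1) obtain n where "\<forall>j\<ge>n. \<omega> j \<notin> A"
        by (auto simp: fin_often_def)
      with C have "\<forall>j\<ge>max m n. \<omega> j \<in> ?C - A"
        by simp
      with elim(2) show False
        by blast
    qed
  qed
  moreover have "{\<omega>. \<omega> m \<in> {s} \<and> (\<forall>j\<ge>m. \<omega> j \<in> ?C)} \<in> sets (path_law \<mu> P)"
    using sets.Int[OF coordinate_event_sets[of m "{s}"] sets[of m ?C]] by (simp add: Collect_conj_eq)
  ultimately have "emeasure (path_law \<mu> P) {\<omega>. \<omega> m \<in> {s} \<and> (\<forall>j\<ge>m. \<omega> j \<in> ?C)} = 0"
    by (subst (asm) AE_iff_null) (auto simp: null_sets_def)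
  \<comment> \<open>Fixing the state at time \<open>m\<close> leaves one term of the integral, whose
    weight is positive because \<open>s\<close> is in the support.\<close>
  then have "(\<integral>\<^sup>+t. stay P ?C s * indicator {s} t \<partial>marginal \<mu> P m) = 0"
    unfolding emeasure_stay by (subst (asm) nn_integral_cong[of _ _ "\<lambda>t. stay P ?C s * indicator {s} t"])
      (auto simp: indicator_def)
  then have "stay P ?C s * ennreal (pmf (marginal \<mu> P m) s) = 0"
    by (simp add: nn_integral_cmult_indicator emeasure_pmf_single)
  then show ?thesis
    using pmf_positive[OF s] by (auto simp: ennreal_eq_0_iff)
qed

theorem theorem4p10:
  fixes \<mu> :: "'s::countable pmf" and P :: "'s \<Rightarrow> 's pmf"
    and k :: nat and A B :: "nat \<Rightarrow> 's set"
  assumes "measure (path_law \<mu> P) (\<Inter>i\<in>{1..k}. fin_often (A i) \<union> inf_often (B i)) = 1"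
  shows "\<exists>(I :: 's set) (V0 :: 's \<Rightarrow> real) (J :: nat \<Rightarrow> 's set)
      (V :: nat \<Rightarrow> 's \<Rightarrow> real) (W :: nat \<Rightarrow> 's \<Rightarrow> real)
      (d :: nat \<Rightarrow> real \<Rightarrow> real) (p :: nat \<Rightarrow> real \<Rightarrow> real).
    (\<forall>s. 0 \<le> V0 s) \<and> pmf_int \<mu> V0 = 0 \<and>
    (\<forall>i\<in>{1..k}.
      J i \<subseteq> I - A i \<and>
      (\<forall>s. 0 \<le> V i s) \<and> (\<forall>s. 0 \<le> W i s) \<and>
      (\<forall>r\<ge>0. 0 < d i r) \<and> (\<forall>r\<ge>0. 0 < p i r \<and> p i r \<le> 1) \<and>
      (\<forall>s. s \<notin> A i \<longrightarrow> pmf_int (P s) (V i) \<le> ennreal (V i s)) \<and>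
      (\<forall>s\<in>A i. 1 \<le> V i s) \<and>
      (\<exists>\<gamma>>0. \<forall>s\<in>J i. V i s \<le> 1 - \<gamma>) \<and>
      (\<forall>s\<in>I - (B i \<union> J i). 0 < W i s \<and> pmf_int (P s) (W i) \<le> ennreal (W i s)) \<and>
      (\<forall>s\<in>I \<inter> (B i \<union> J i). W i s = 0) \<and>
      (\<forall>r>0. \<forall>s\<in>I - (B i \<union> J i). W i s = r \<longrightarrow>
         p i r \<le> measure_pmf.prob (P s) {s'. W i s' \<le> r - d i r}) \<and>
      antimono_on {0<..} (p i) \<and> antimono_on {0<..} (d i)) \<and>
    (\<forall>s\<in>I. pmf_int (P s) V0 \<le> ennreal (V0 s)) \<and>
    (\<forall>s. s \<notin> I \<longrightarrow> 1 \<le> V0 s)"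
proof -
  \<comment> \<open>Reachable states: this set carries \<open>\<mu>\<close> and is closed under
    transitions, so the indicator of its complement has mean 0 from \<open>\<mu>\<close> and from
    every state of \<open>I\<close>.\<close>
  define I where "I = (\<Union>m. set_pmf (marginal \<mu> P m))"
  define V0 where "V0 s = (indicator (- I) s :: real)" for s
  have init: "set_pmf \<mu> \<subseteq> I"
    unfolding I_def by (metis UN_upper UNIV_I marginal.simps(1))
  have closed: "set_pmf (P s) \<subseteq> I" if s: "s \<in> I" for s
  proof -
    obtain m where "s \<in> set_pmf (marginal \<mu> P m)"
      using s by (auto simp: I_def)
    then have "set_pmf (P s) \<subseteq> set_pmf (marginal \<mu> P (Suc m))"
      by auto
    then show ?thesis
      unfolding I_def by blast
  qed
  have V0: "pmf_int \<nu> V0 = 0" if "set_pmf \<nu> \<subseteq> I" for \<nu>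
    unfolding pmf_int_def V0_def using that
    by (subst nn_integral_0_iff_AE) (auto simp: AE_measure_pmf_iff)
  have leaves: "stay P {s. s \<notin> B i \<and> stay P (- A i) s < ennreal (1 / 2)} s = 0" if "i \<in> {1..k}" "s \<in> I" for i s
  proof -
    interpret prob_space "path_law \<mu> P"
      by (rule prob_space_path_law)
    have "AE \<omega> in path_law \<mu> P. \<omega> \<in> (\<Inter>i\<in>{1..k}. fin_often (A i) \<union> inf_often (B i))"
      using assms by (intro AE_prob_1)
    then have "AE \<omega> in path_law \<mu> P. \<omega> \<in> fin_often (A i) \<union> inf_often (B i)"
      using that(1) by (auto elim!: eventually_mono)
    then show ?thesis
      using stay_eq_0_of_streett that(2) unfolding I_def by blast
  qed
  have nonneg: "\<forall>s. 0 \<le> V0 s" and init0: "pmf_int \<mu> V0 = 0"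
    and step0: "\<forall>s\<in>I. pmf_int (P s) V0 \<le> ennreal (V0 s)" and outside: "\<forall>s. s \<notin> I \<longrightarrow> 1 \<le> V0 s"
    using V0[OF init] V0[OF closed] by (auto simp: V0_def)
  have "\<forall>i\<in>{1..k}. \<exists>J V W d p. streett_certificate P I (A i) (B i) J V W d p"
    using streett_pair_certificate[OF closed leaves] by blast
  then obtain J V W d p where
    "\<forall>i\<in>{1..k}. streett_certificate P I (A i) (B i) (J i) (V i) (W i) (d i) (p i)"
    unfolding bchoice_iff by blast
  with nonneg init0 step0 outside show ?thesis
    unfolding streett_certificate_def
    by - (rule exI[of _ I], rule exI[of _ V0], rule exI[of _ J], rule exI[of _ V], rule exI[of _ W],
        rule exI[of _ d], rule exI[of _ p], intro conjI)
qed

end
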